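(* Let $k,n\ge 1$ be integers. In a uniformly randomly arranged deck of $kn$ cards consisting of $k$ suits with $n$ cards in each suit (one card of each of $n$ ranks per suit), the expected number of matches $M$ satisfies $\mathrm{E}(M)=k-1$.
   Context: The deck has $kn$ distinct cards, one for each pair (suit, rank) with $k$ suits and $n$ ranks, so each rank occurs on exactly $k$ cards. All $(kn)!$ orderings are equally likely. For $1\le i\le kn-1$ let $M_i$ be the indicator random variable of the event that the cards in positions $i$ and $i+1$ have the same rank. The number of matches is $M=\sum_{i=1}^{kn-1}M_i$ (so, e.g., three consecutive cards of the same rank count as two matches). *)

theory Defs
  imports "HOL-Probability.Probability" "HOL-Combinatorics.Multiset_Permutations"
begin

type_synonym card = "nat \<times> nat"  \<comment> \<open>(suit, rank)\<close>

definition deck :: "nat \<Rightarrow> nat \<Rightarrow> card set" where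
  "deck k n = {..<k} \<times> {..<n}"

definition shuffled_deck :: "nat \<Rightarrow> nat \<Rightarrow> card list pmf" where
  "shuffled_deck k n = pmf_of_set (permutations_of_set (deck k n))"

text \<open>Positions are counted from 1, so the cards in positions \<open>i\<close> and \<open>i + 1\<close> are the list
  entries with indices \<open>i - 1\<close> and \<open>i\<close>.\<close>

definition match_ind :: "nat \<Rightarrow> card list \<Rightarrow> real" where
  "match_ind i = indicator {cs. snd (cs ! (i - 1)) = snd (cs ! i)}"

definition num_matches :: "nat \<Rightarrow> nat \<Rightarrow> card list \<Rightarrow> real" where
  "num_matches k n cs = (\<Sum>i = 1..k * n - 1. match_ind i cs)"

end

theory Submission
  imports Defs
begin

text \<open>
  By linearity of expectation, it suffices to know the probability that two given distinct positions
  hold cards of the same rank. Rearranging the positions by a fixed permutation preserves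
  the uniform distribution on orderings, and any ordered pair of distinct positions can be carried to
  any other, so this probability does not depend on the positions. It is therefore its own average
  over all ordered pairs of distinct positions. In \<^emph>\<open>every\<close> single ordering, that
  average is the same number, because the positions enumerate the cards bijectively: it is the
  proportion of pairs of equal rank among all ordered pairs of distinct cards
  (\<open>expectation_two_positions\<close>). Each of the \<open>k * n\<close> cards has
  \<open>k - 1\<close> partners of its rank among the \<open>k * n - 1\<close> other cards, so the proportion
  is \<open>(k - 1) / (k * n - 1)\<close>, and summing over the \<open>k * n - 1\<close> adjacent pairs of
  positions gives \<open>k - 1\<close>. A deck of one card has no pair of positions, and there both sides vanish.
\<close>

definition distinct_pairs :: "'a set \<Rightarrow> ('a \<times> 'a) set" where
  "distinct_pairs A = {(x, y). x \<in> A \<and> y \<in> A \<and> x \<noteq> y}"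

lemma distinct_pairs_eq_Sigma: "distinct_pairs A = (SIGMA x:A. A - {x})"
  by (auto simp: distinct_pairs_def)

lemma card_distinct_pairs:
  assumes "finite A"
  shows "card (distinct_pairs A) = card A * (card A - 1)"
  using assms by (simp add: distinct_pairs_eq_Sigma)

lemma bij_betw_distinct_pairs:
  assumes "bij_betw h A B"
  shows "bij_betw (map_prod h h) (distinct_pairs A) (distinct_pairs B)"
proof -
  have inj: "inj_on h A" and im: "h ` A = B"
    using assms by (auto simp: bij_betw_def)
  have "map_prod h h ` distinct_pairs A = distinct_pairs B"
    using inj unfolding im[symmetric]
    by (force simp: distinct_pairs_def inj_on_eq_iff image_iff)
  moreover have "inj_on (map_prod h h) (distinct_pairs A)"
    using inj by (auto simp: distinct_pairs_def inj_on_def)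
  ultimately show ?thesis
    by (simp add: bij_betw_def)
qed

text \<open>
  Two transpositions suffice: the first moves the first point to its target, and the second
  corrects the image of the second point without touching the first target.
\<close>

lemma permutes_two_points:
  assumes "(i, j) \<in> distinct_pairs A" "(i', j') \<in> distinct_pairs A"
  obtains p where "p permutes A" "p i = i'" "p j = j'"
proof
  let ?s = "Transposition.transpose i i'"
  have "?s j \<in> A"
    using assms by (auto simp: distinct_pairs_def Transposition.transpose_def)
  then show "Transposition.transpose (?s j) j' \<circ> ?s permutes A"
    using assms by (intro permutes_compose permutes_swap_id) (auto simp: distinct_pairs_def)
  show "(Transposition.transpose (?s j) j' \<circ> ?s) i = i'" "(Transposition.transpose (?s j) j' \<circ> ?s) j = j'"
    using assms by (auto simp: distinct_pairs_def Transposition.transpose_def)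
qed

lemma permute_list_in_permutations_of_set:
  assumes "xs \<in> permutations_of_set A" "p permutes {..<card A}"
  shows "permute_list p xs \<in> permutations_of_set A"
  using assms by (auto simp: permutations_of_set_def distinct_card)

lemma sum_permutations_of_set_permute_list:
  assumes p: "p permutes {..<card A}"
  shows "(\<Sum>xs\<in>permutations_of_set A. g (permute_list p xs)) = (\<Sum>xs\<in>permutations_of_set A. g xs)"
proof (rule sum.reindex_bij_witness[where i = "permute_list (inv p)" and j = "permute_list p"])
  fix xs assume xs: "xs \<in> permutations_of_set A"
  then have len: "length xs = card A"
    by (simp add: length_finite_permutations_of_set)
  show "permute_list (inv p) (permute_list p xs) = xs"
    using p len permutes_inv[OF p]
    by (simp add: permute_list_compose[symmetric] permutes_inv_o)
  show "permute_list p (permute_list (inv p) xs) = xs"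
    using p len permutes_inv[OF p]
    by (simp add: permute_list_compose[symmetric] permutes_inv_o)
  show "permute_list p xs \<in> permutations_of_set A"
    "permute_list (inv p) xs \<in> permutations_of_set A"
    using xs p permutes_inv[OF p] by (auto intro: permute_list_in_permutations_of_set)
qed simp

lemma sum_two_positions_exchangeable:
  assumes "(i, j) \<in> distinct_pairs {..<card A}" "(i', j') \<in> distinct_pairs {..<card A}"
  shows "(\<Sum>xs\<in>permutations_of_set A. f (xs ! i, xs ! j)) =
         (\<Sum>xs\<in>permutations_of_set A. f (xs ! i', xs ! j'))"
proof -
  obtain p where p: "p permutes {..<card A}" "p i = i'" "p j = j'"
    using permutes_two_points[OF assms] .
  have "(\<Sum>xs\<in>permutations_of_set A. f (xs ! i, xs ! j)) =
      (\<Sum>xs\<in>permutations_of_set A. f (permute_list p xs ! i, permute_list p xs ! j))"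
    using sum_permutations_of_set_permute_list[OF p(1), of "\<lambda>xs. f (xs ! i, xs ! j)"] by simp
  also have "\<dots> = (\<Sum>xs\<in>permutations_of_set A. f (xs ! i', xs ! j'))"
    using assms p
    by (intro sum.cong refl)
       (auto simp: permute_list_nth length_finite_permutations_of_set distinct_pairs_def)
  finally show ?thesis .
qed

lemma sum_distinct_positions:
  assumes "xs \<in> permutations_of_set A"
  shows "(\<Sum>(i, j)\<in>distinct_pairs {..<card A}. f (xs ! i, xs ! j)) = sum f (distinct_pairs A)"
proof -
  have "bij_betw (nth xs) {..<card A} A"
    using assms by (intro bij_betw_nth) (auto simp: permutations_of_set_def distinct_card)
  then show ?thesis
    using sum.reindex_bij_betw[OF bij_betw_distinct_pairs, of "nth xs" _ _ f]
    by (simp add: case_prod_unfold map_prod_def)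
qed

text \<open>
  The entries at two distinct positions of a uniformly random ordering form a uniformly random
  ordered pair of distinct elements. This is proved by summing over all pairs of positions:
  exchangeability makes the summands equal, while the total is constant in the ordering.
\<close>

lemma expectation_two_positions:
  fixes f :: "'a \<times> 'a \<Rightarrow> real"
  assumes A: "finite A" and ij: "(i, j) \<in> distinct_pairs {..<card A}"
  shows "measure_pmf.expectation (pmf_of_set (permutations_of_set A)) (\<lambda>xs. f (xs ! i, xs ! j)) =
         sum f (distinct_pairs A) / (real (card A) * real (card A - 1))"
proof -
  let ?S = "permutations_of_set A" and ?P = "distinct_pairs {..<card A}"
  let ?T = "\<Sum>xs\<in>?S. f (xs ! i, xs ! j)"
  have S: "finite ?S" "?S \<noteq> {}"
    using A by (auto simp: permutations_of_set_empty_iff)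
  have P: "finite ?P" "real (card ?P) = real (card A) * real (card A - 1)"
    by (simp_all add: card_distinct_pairs) (simp add: distinct_pairs_eq_Sigma)
  have "card ?P > 0"
    using P(1) ij by (auto simp: card_gt_0_iff)
  have "real (card ?P) * ?T = (\<Sum>(i', j')\<in>?P. ?T)"
    by (simp add: case_prod_unfold)
  also have "\<dots> = (\<Sum>(i', j')\<in>?P. \<Sum>xs\<in>?S. f (xs ! i', xs ! j'))"
    by (intro sum.cong refl) (auto intro!: sum_two_positions_exchangeable ij)
  also have "\<dots> = (\<Sum>xs\<in>?S. \<Sum>(i', j')\<in>?P. f (xs ! i', xs ! j'))"
    unfolding case_prod_unfold by (rule sum.swap)
  also have "\<dots> = real (card ?S) * sum f (distinct_pairs A)"
    by (simp add: sum_distinct_positions)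
  finally have "?T / real (card ?S) = sum f (distinct_pairs A) / real (card ?P)"
    using \<open>card ?P > 0\<close> S by (simp add: field_simps)
  then show ?thesis
    using S P(2) by (simp add: integral_pmf_of_set)
qed

lemma finite_deck: "finite (deck k n)" and card_deck: "card (deck k n) = k * n"
  by (simp_all add: deck_def)

lemma sum_equal_rank_deck:
  "(\<Sum>(c, d)\<in>distinct_pairs (deck k n). of_bool (snd c = snd d)) = real (k * n) * real (k - 1)"
proof -
  \<comment> \<open>The cards of rank \<open>snd c\<close> other than \<open>c\<close> form one card for each remaining suit.\<close>
  have partners: "(deck k n - {c}) \<inter> {d. snd c = snd d} = ({..<k} - {fst c}) \<times> {snd c}"
    if "c \<in> deck k n" for c
    using that by (auto simp: deck_def)
  have "(\<Sum>(c, d)\<in>distinct_pairs (deck k n). of_bool (snd c = snd d)) =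
      (\<Sum>c\<in>deck k n. \<Sum>d\<in>deck k n - {c}. of_bool (snd c = snd d) :: real)"
    unfolding distinct_pairs_eq_Sigma by (subst sum.Sigma) (auto simp: finite_deck)
  also have "\<dots> = (\<Sum>c\<in>deck k n. real (k - 1))"
  proof (rule sum.cong)
    fix c assume c: "c \<in> deck k n"
    then have "fst c < k"
      by (auto simp: deck_def)
    then show "(\<Sum>d\<in>deck k n - {c}. of_bool (snd c = snd d) :: real) = real (k - 1)"
      using c by (simp add: sum_of_bool_eq finite_deck partners card_cartesian_product)
  qed simp
  finally show ?thesis
    by (simp add: card_deck)
qed

lemma expectation_match_ind:
  assumes "1 \<le> i" "i \<le> k * n - 1"
  shows "measure_pmf.expectation (shuffled_deck k n) (match_ind i) = real (k - 1) / real (k * n - 1)"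
proof -
  have "(i - 1, i) \<in> distinct_pairs {..<card (deck k n)}"
    using assms by (auto simp: distinct_pairs_def card_deck)
  from expectation_two_positions[OF finite_deck this, of "\<lambda>(c, d). of_bool (snd c = snd d)"]
  show ?thesis
    using assms unfolding sum_equal_rank_deck
    by (simp add: shuffled_deck_def match_ind_def[abs_def] indicator_def[abs_def] card_deck
        split: if_splits)
qed

theorem theorem1:
  fixes k n :: nat
  assumes "k \<ge> 1" and "n \<ge> 1"
  shows "measure_pmf.expectation (shuffled_deck k n) (num_matches k n) = real k - 1"
proof -
  have "finite (set_pmf (shuffled_deck k n))"
    by (simp add: shuffled_deck_def permutations_of_set_empty_iff finite_deck)
  then have "measure_pmf.expectation (shuffled_deck k n) (num_matches k n) =
      (\<Sum>i = 1..k * n - 1. measure_pmf.expectation (shuffled_deck k n) (match_ind i))"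
    unfolding num_matches_def[abs_def]
    by (intro Bochner_Integration.integral_sum integrable_measure_pmf_finite)
  also have "\<dots> = real (k * n - 1) * (real (k - 1) / real (k * n - 1))"
    by (simp add: expectation_match_ind)
  also have "\<dots> = real k - 1"
    \<comment> \<open>For a single card the quotient is \<open>0 / 0 = 0\<close>, so it cannot be cancelled.\<close>
  proof (cases "k * n = 1")
    case True
    then show ?thesis by simp
  next
    case False
    with assms have "k * n > 1"
      by (metis One_nat_def Suc_leI le_neq_implies_less mult_le_mono nat_mult_1)
    then have "real (k * n - 1) \<noteq> 0"
      by simp
    then have "real (k * n - 1) * (real (k - 1) / real (k * n - 1)) = real (k - 1)"
      by (rule nonzero_mult_div_cancel_left[THEN trans[OF times_divide_eq_right]])
    with assms show ?thesis
      by (simp only: of_nat_diff of_nat_1)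
  qed
  finally show ?thesis .
qed

end
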